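(* Let $p\ge 2$, and let $K,K'$ be oriented simple closed curves on the genus-2 Heegaard surface $F$ of $L(p,1)$ with homology vectors $\mathbf v=[K]=(a,x,b,y)^T$ and $\mathbf v'=[K']=(a',x',b',y')^T$ in $H_1(F;\mathbb Z)\cong\mathbb Z^4$. Suppose there exists a Goeritz group element $g\in\mathcal G_p$ carrying $K$ to $K'$. Let $\varepsilon=-1$ if $p=3$ and $\varepsilon=1$ otherwise, and write the induced matrix $g_*\in\mathcal S_p$ in the form $$g_*=\omega\begin{pmatrix} kp+1&\ell&\varepsilon(k-\Delta n)&\varepsilon\Delta m\\ mp&np+\Delta&\varepsilon m&0\\ 0&0&\Delta np+1&-\Delta mp\\ 0&0&-\Delta\ell&\Delta(kp+1)\end{pmatrix},$$ with $k,\ell,m,n\in\mathbb Z$, $\omega\in\{\pm1\}$ and $\Delta=\det\begin{pmatrix}kp+1&\ell\\ mp&np+\Delta\end{pmatrix}\in\{\pm1\}$. Put $s=ap+\varepsilon b$, $s'=a'p+\varepsilon b'$, $\delta=bs+xyp$, $\delta'=b's'+x'y'p$. Then: 1. $b'\equiv\omega b\pmod p$; 2. $\gcd(b,y)=\gcd(b',y')$; 3. $\delta$ and $\delta'$ divide each of $\Delta bx'-b'x$, $\;bs'+\Delta xy'p$, $\;b's+\Delta x'yp$, and $ys'-\Delta y's$; 4. $|(\Delta bx'-b'x)p|\le 2|bs'+\Delta xy'p|$ or $p|ys'-\Delta y's|\le 2|b's+\Delta x'yp|$.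
   Context: Let $p\ge2$. Let $(F',V',W')$ be the genus one Heegaard splitting of the lens space $L(p,1)$ with the $(p,1)$-torus knot bounding a disk in the solid torus $V'$, and let $(F,V,W)$ be its genus-2 stabilization. The Goeritz group $\mathcal G_p$ is the group of isotopy classes of orientation-preserving self-homeomorphisms of $L(p,1)$ preserving the splitting $(F,V,W)$ (each of $V$ and $W$) set-wise. By a theorem of Cho (which may be used), $\mathcal G_p$ has the presentation: - $p=2$: $\langle\beta,\rho,\gamma\mid\rho^4=\gamma^2=(\gamma\rho)^2=\rho^2\beta\rho^2\beta^{-1}=1\rangle$; - $p=3$: $\langle\alpha\mid\alpha^2=1\rangle\oplus\langle\beta,\delta,\gamma\mid\delta^3=\gamma^2=(\gamma\delta)^2=1\rangle$; - $p\ge4$: $\langle\alpha\mid\alpha^2=1\rangle\oplus\langle\beta,\gamma,\sigma\mid\gamma^2=\sigma^2=1\rangle$, where the generators are specific homeomorphisms. (The generator $\delta$ for $p=3$ is unrelated to the integer $\delta$ in the claim.) $H_1(F;\mathbb Z)\cong\mathbb Z^4$ has an ordered basis $\mathbf a,\mathbf x,\mathbf b,\mathbf y$ represented by oriented curves $a,x,b,y$ on $F$, where $a$ and $x$ bound disks in $W$, $y$ bounds a disk in $V$, $a$ meets $b$ once, $x$ meets $y$ once, the other pairs are disjoint, and the cross products of tangent vectors $a\times b$ and $x\times y$ point into $V$. A vector $(a,x,b,y)^T$ denotes coordinates in this basis. The star map $*:\mathcal G_p\to GL(4,\mathbb Z)$, $g\mapsto g_*$, is the induced action on $H_1(F;\mathbb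 Z)$ in this basis. It is given on generators by $$\alpha_*=-I_4,\quad \beta_*=\mathrm{diag}(1,-1,1,-1),\quad \gamma_*=\begin{pmatrix}1&1&0&0\\0&-1&0&0\\0&0&1&0\\0&0&1&-1\end{pmatrix},\quad \delta_*=\begin{pmatrix}-2&-1&1&-1\\3&1&-1&0\\0&0&1&-3\\0&0&1&-2\end{pmatrix},$$ $$\rho_*=\begin{pmatrix}1&1&1&-1\\-2&-1&-1&0\\0&0&-1&2\\0&0&-1&1\end{pmatrix},\quad \sigma_*=\begin{pmatrix}1&0&0&1\\-p&-1&-1&0\\0&0&1&-p\\0&0&0&-1\end{pmatrix}.$$ $\mathcal S_p$ denotes the set of all integer matrices of the displayed form in the claim (over all $k,\ell,m,n\in\mathbb Z$, $\omega,\Delta\in\{\pm1\}$ with $\det\begin{pmatrix}kp+1&\ell\\ mp&np+\Delta\end{pmatrix}=\Delta$); every $g_*$ with $g\in\mathcal G_p$ lies in $\mathcal S_p$. *)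

theory Defs
  imports
    "HOL-Analysis.Analysis"
    "HOL-Homology.Homology"
    "HOL-Algebra.Bij"
    "HOL-Number_Theory.Cong"
begin

section \<open>Lens spaces and Heegaard splittings\<close>

text \<open>The lens space is the quotient of the unit sphere of \<open>\<complex>\<^sup>2\<close> by
  \<open>(z, w) \<mapsto> (\<zeta> z, \<zeta>\<^sup>q w)\<close> with \<open>\<zeta> = exp (2 \<pi> i / p)\<close>.\<close>

definition lens_space :: "nat \<Rightarrow> nat \<Rightarrow> 'a topology \<Rightarrow> bool" where
  "lens_space p q M \<longleftrightarrow>
     (\<exists>f. quotient_map (top_of_set (sphere (0 :: complex \<times> complex) 1)) M f \<and>
        (\<forall>u \<in> sphere 0 1. \<forall>v \<in> sphere 0 1. f u = f v \<longleftrightarrow>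
           (\<exists>j::nat. v = (cis (2 * pi * real j / real p) * fst u,
                          cis (2 * pi * real j * real q / real p) * snd u))))"

definition bounds_disk :: "'a topology \<Rightarrow> 'a set \<Rightarrow> 'a set \<Rightarrow> 'a set \<Rightarrow> bool" where
  "bounds_disk M V F C \<longleftrightarrow>
     (\<exists>e. embedding_map (top_of_set (cball (0::complex) 1)) M e \<and>
          e ` cball 0 1 \<subseteq> V \<and> e ` ball 0 1 \<inter> F = {} \<and> e ` sphere 0 1 = C)"

text \<open>Model of the genus \<open>g\<close> handlebody: (a round disk with \<open>g\<close> round holes) times an interval.\<close>

definition standard_handlebody :: "nat \<Rightarrow> (complex \<times> real) set" where
  "standard_handlebody g =
     (cball 0 (4 * real g + 1) - (\<Union>j<g. ball (of_nat (4 * j)) 1)) \<times> {0..1}"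

definition handlebody :: "nat \<Rightarrow> 'a topology \<Rightarrow> 'a set \<Rightarrow> 'a set \<Rightarrow> bool" where
  "handlebody g M V F \<longleftrightarrow>
     (\<exists>h. homeomorphic_map (subtopology M V) (top_of_set (standard_handlebody g)) h \<and>
          h ` F = frontier (standard_handlebody g))"

definition heegaard_splitting :: "nat \<Rightarrow> 'a topology \<Rightarrow> 'a set \<Rightarrow> 'a set \<Rightarrow> 'a set \<Rightarrow> bool" where
  "heegaard_splitting g M F V W \<longleftrightarrow>
     closedin M V \<and> closedin M W \<and> V \<union> W = topspace M \<and> V \<inter> W = F \<and>
     handlebody g M V F \<and> handlebody g M W F"

text \<open>In coordinates \<open>S\<^sup>1 \<times> D\<^sup>2\<close> on \<open>W\<close>, the \<open>(p,1)\<close>-torus knot \<open>z \<mapsto> (z\<^sup>p, z)\<close> on the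
  boundary torus runs \<open>p\<close> times along the core and once around the meridian.\<close>

definition torus_knot_bounds :: "nat \<Rightarrow> 'a topology \<Rightarrow> 'a set \<Rightarrow> 'a set \<Rightarrow> 'a set \<Rightarrow> bool" where
  "torus_knot_bounds p M F V W \<longleftrightarrow>
     (\<exists>h. homeomorphic_map (subtopology M W)
            (top_of_set (sphere (0::complex) 1 \<times> cball (0::complex) 1)) h \<and>
          h ` F = sphere 0 1 \<times> sphere 0 1 \<and>
          bounds_disk M V F {w \<in> W. \<exists>z \<in> sphere 0 1. h w = (z ^ p, z)})"

text \<open>\<open>V\<close> arises from \<open>V'\<close> by attaching the 1-handle \<open>\<phi> (D\<^sup>2 \<times> [0,1])\<close> contained in \<open>W'\<close>,
  and \<open>W\<close> is the closure of the rest of \<open>W'\<close>.  The handle is trivial: a properly embedded disk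
  of \<open>W\<close> has a boundary running exactly once along the handle, i.e. the core of the handle is
  parallel into \<open>F'\<close>.\<close>

definition stabilization ::
  "'a topology \<Rightarrow> 'a set \<Rightarrow> 'a set \<Rightarrow> 'a set \<Rightarrow> 'a set \<Rightarrow> 'a set \<Rightarrow> 'a set \<Rightarrow> bool" where
  "stabilization M F' V' W' F V W \<longleftrightarrow>
     (\<exists>\<phi> C. embedding_map (top_of_set (cball (0::complex) 1 \<times> {0..1::real})) M \<phi> \<and>
        \<phi> ` (cball 0 1 \<times> {0..1}) \<subseteq> W' \<and>
        (\<forall>z \<in> cball 0 1. \<forall>t \<in> {0..1}. \<phi> (z, t) \<in> F' \<longleftrightarrow> t = 0 \<or> t = 1) \<and>
        V = V' \<union> \<phi> ` (cball 0 1 \<times> {0..1}) \<and>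
        W = W' - \<phi> ` (ball 0 1 \<times> {0..1}) \<and>
        F = V \<inter> W \<and>
        bounds_disk M W F C \<and> C \<subseteq> F \<and>
        C \<inter> \<phi> ` (cball 0 1 \<times> {0..1}) = \<phi> ` ({1} \<times> {0..1}))"

section \<open>Orientations\<close>

text \<open>For a closed connected orientable 3-manifold \<open>M\<close>, an orientation is a generator \<open>\<mu>\<close> of
  \<open>H\<^sub>3(M)\<close>; an orientation of \<open>\<real>\<^sup>3\<close> is a generator \<open>\<nu>\<close> of \<open>H\<^sub>3(\<real>\<^sup>3, \<real>\<^sup>3 - 0)\<close>.\<close>

definition is_generator :: "'g monoid \<Rightarrow> 'g \<Rightarrow> bool" where
  "is_generator G x \<longleftrightarrow> x \<in> carrier G \<and> generate G {x} = carrier G"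

definition orientation_class :: "'a topology \<Rightarrow> 'a chain set \<Rightarrow> bool" where
  "orientation_class M \<mu> \<longleftrightarrow> is_generator (homology_group 3 M) \<mu>"

definition space_orientation :: "(real^3) chain set \<Rightarrow> bool" where
  "space_orientation \<nu> \<longleftrightarrow> is_generator (relative_homology_group 3 euclidean (- {0 :: real^3})) \<nu>"

definition oriented_chart ::
  "'a topology \<Rightarrow> 'a chain set \<Rightarrow> (real^3) chain set \<Rightarrow> (real^3 \<Rightarrow> 'a) \<Rightarrow> bool" where
  "oriented_chart M \<mu> \<nu> \<phi> \<longleftrightarrow>
     embedding_map euclidean M \<phi> \<and> openin M (range \<phi>) \<and>
     hom_induced 3 M {} M (topspace M - {\<phi> 0}) id \<mu> =
     hom_induced 3 euclidean (- {0}) M (topspace M - {\<phi> 0}) \<phi> \<nu>"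

section \<open>Oriented curves and their homology classes\<close>

text \<open>Oriented closed curves are maps of the unit circle with its counterclockwise orientation.\<close>

definition simple_closed_curve :: "'a topology \<Rightarrow> (complex \<Rightarrow> 'a) \<Rightarrow> bool" where
  "simple_closed_curve X k \<longleftrightarrow> embedding_map (top_of_set (sphere 0 1)) X k"

definition curve_class :: "'a topology \<Rightarrow> (complex \<Rightarrow> 'a) \<Rightarrow> 'a chain set" where
  "curve_class X k =
     homologous_rel_set 1 X {}
       (frag_of (\<lambda>t \<in> standard_simplex 1. k (cis (2 * pi * t 1))))"

text \<open>\<open>h\<close> maps \<open>k\<close> onto \<open>k'\<close> as oriented curves: up to an orientation-preserving
  reparametrization of the circle (a homeomorphism homotopic to the identity).\<close>

definition carries_curve :: "('a \<Rightarrow> 'a) \<Rightarrow> (complex \<Rightarrow> 'a) \<Rightarrow> (complex \<Rightarrow> 'a) \<Rightarrow> bool" where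
  "carries_curve h k k' \<longleftrightarrow>
     (\<exists>r. homeomorphic_map (top_of_set (sphere 0 1)) (top_of_set (sphere 0 1)) r \<and>
          homotopic_with (\<lambda>_. True) (top_of_set (sphere 0 1)) (top_of_set (sphere 0 1)) r id \<and>
          (\<forall>z \<in> sphere 0 1. h (k z) = k' (r z)))"

text \<open>\<open>k\<close> and \<open>l\<close> meet in exactly one point, transversally in \<open>F\<close>, and the cross product of
  their tangent vectors there points into \<open>V\<close>: in an orientation-preserving chart around the point,
  \<open>k\<close> runs along the first axis, \<open>l\<close> along the second one, and the third one points into \<open>V\<close>.\<close>

definition crosses_once_into ::
  "'a topology \<Rightarrow> 'a chain set \<Rightarrow> (real^3) chain set \<Rightarrow> 'a set \<Rightarrow> 'a set \<Rightarrow>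
   (complex \<Rightarrow> 'a) \<Rightarrow> (complex \<Rightarrow> 'a) \<Rightarrow> bool" where
  "crosses_once_into M \<mu> \<nu> V W k l \<longleftrightarrow>
     (\<exists>\<phi> \<theta> \<eta>. oriented_chart M \<mu> \<nu> \<phi> \<and>
        k ` sphere 0 1 \<inter> l ` sphere 0 1 = {\<phi> 0} \<and>
        (\<forall>u. \<phi> u \<in> V \<longleftrightarrow> 0 \<le> u $ 3) \<and> (\<forall>u. \<phi> u \<in> W \<longleftrightarrow> u $ 3 \<le> 0) \<and>
        strict_mono \<theta> \<and> continuous_on UNIV \<theta> \<and>
        (\<forall>t. \<phi> (vector [t, 0, 0]) = k (cis (\<theta> t))) \<and>
        strict_mono \<eta> \<and> continuous_on UNIV \<eta> \<and>
        (\<forall>t. \<phi> (vector [0, t, 0]) = l (cis (\<eta> t))))"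

definition class_comb :: "'a topology \<Rightarrow> (4 \<Rightarrow> complex \<Rightarrow> 'a) \<Rightarrow> int^4 \<Rightarrow> 'a chain set" where
  "class_comb X c v =
     finprod (homology_group 1 X)
       (\<lambda>i. curve_class X (c i) [^]\<^bsub>homology_group 1 X\<^esub> (v $ i)) UNIV"

definition homology_basis :: "'a topology \<Rightarrow> (4 \<Rightarrow> complex \<Rightarrow> 'a) \<Rightarrow> bool" where
  "homology_basis X c \<longleftrightarrow> bij_betw (class_comb X c) UNIV (carrier (homology_group 1 X))"

definition homology_coords :: "'a topology \<Rightarrow> (4 \<Rightarrow> complex \<Rightarrow> 'a) \<Rightarrow> 'a chain set \<Rightarrow> int^4" where
  "homology_coords X c \<xi> = inv_into UNIV (class_comb X c) \<xi>"

text \<open>The curves \<open>c 1, c 2, c 3, c 4\<close> are \<open>a, x, b, y\<close>.\<close>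

definition standard_curves ::
  "'a topology \<Rightarrow> 'a chain set \<Rightarrow> (real^3) chain set \<Rightarrow> 'a set \<Rightarrow> 'a set \<Rightarrow> 'a set \<Rightarrow>
   (4 \<Rightarrow> complex \<Rightarrow> 'a) \<Rightarrow> bool" where
  "standard_curves M \<mu> \<nu> F V W c \<longleftrightarrow>
     (\<forall>i. simple_closed_curve (subtopology M F) (c i)) \<and>
     homology_basis (subtopology M F) c \<and>
     bounds_disk M W F (c 1 ` sphere 0 1) \<and>
     bounds_disk M W F (c 2 ` sphere 0 1) \<and>
     bounds_disk M V F (c 4 ` sphere 0 1) \<and>
     crosses_once_into M \<mu> \<nu> V W (c 1) (c 3) \<and>
     crosses_once_into M \<mu> \<nu> V W (c 2) (c 4) \<and>
     (\<forall>(i, j) \<in> {(1, 2), (1, 4), (2, 3), (3, 4)}.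
        c i ` sphere 0 1 \<inter> c j ` sphere 0 1 = {})"

section \<open>The Goeritz group and the star map\<close>

definition preserves_splitting ::
  "'a topology \<Rightarrow> 'a set \<Rightarrow> 'a set \<Rightarrow> ('a \<Rightarrow> 'a) \<Rightarrow> bool" where
  "preserves_splitting M V W h \<longleftrightarrow> homeomorphic_map M M h \<and> h ` V = V \<and> h ` W = W"

definition splitting_homeo_group ::
  "'a topology \<Rightarrow> 'a chain set \<Rightarrow> 'a set \<Rightarrow> 'a set \<Rightarrow> ('a \<Rightarrow> 'a) monoid" where
  "splitting_homeo_group M \<mu> V W =
     BijGroup (topspace M)
       \<lparr>carrier := {h \<in> Bij (topspace M).
          preserves_splitting M V W h \<and> hom_induced 3 M {} M {} h \<mu> = \<mu>}\<rparr>"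

definition isotopic_to_id ::
  "'a topology \<Rightarrow> 'a chain set \<Rightarrow> 'a set \<Rightarrow> 'a set \<Rightarrow> ('a \<Rightarrow> 'a) set" where
  "isotopic_to_id M \<mu> V W =
     {h \<in> carrier (splitting_homeo_group M \<mu> V W).
        homotopic_with (preserves_splitting M V W) M M id h}"

text \<open>An element is an isotopy class of homeomorphisms, represented as a coset of the
  homeomorphisms isotopic to the identity.\<close>

definition goeritz_group ::
  "'a topology \<Rightarrow> 'a chain set \<Rightarrow> 'a set \<Rightarrow> 'a set \<Rightarrow> ('a \<Rightarrow> 'a) set monoid" where
  "goeritz_group M \<mu> V W = splitting_homeo_group M \<mu> V W Mod isotopic_to_id M \<mu> V W"

text \<open>The \<open>j\<close>-th column holds the coordinates of the image of the \<open>j\<close>-th basis element; the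
  induced map on homology does not depend on the representative.\<close>

definition star :: "'a topology \<Rightarrow> (4 \<Rightarrow> complex \<Rightarrow> 'a) \<Rightarrow> ('a \<Rightarrow> 'a) set \<Rightarrow> int^4^4" where
  "star X c g =
     (\<chi> i j. homology_coords X c
        (hom_induced 1 X {} X {} (SOME h. h \<in> g) (curve_class X (c j))) $ i)"

section \<open>Group presentations\<close>

text \<open>A letter \<open>(s, True)\<close> is the generator \<open>s\<close>, and \<open>(s, False)\<close> is its inverse.\<close>

type_synonym 's word = "('s \<times> bool) list"

inductive word_equiv :: "'s set \<Rightarrow> 's word set \<Rightarrow> 's word \<Rightarrow> 's word \<Rightarrow> bool" for S R where
  refl: "word_equiv S R w w"
| sym: "word_equiv S R v w \<Longrightarrow> word_equiv S R w v"
| trans: "word_equiv S R u v \<Longrightarrow> word_equiv S R v w \<Longrightarrow> word_equiv S R u w"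
| cancel: "s \<in> S \<Longrightarrow> word_equiv S R (u @ [(s, e), (s, \<not> e)] @ v) (u @ v)"
| relator: "r \<in> R \<Longrightarrow> word_equiv S R (u @ r @ v) (u @ v)"

definition word_value :: "('g, 'm) monoid_scheme \<Rightarrow> ('s \<Rightarrow> 'g) \<Rightarrow> 's word \<Rightarrow> 'g" where
  "word_value G f w =
     foldr (\<lambda>(s, e) x. (if e then f s else inv\<^bsub>G\<^esub> (f s)) \<otimes>\<^bsub>G\<^esub> x) w \<one>\<^bsub>G\<^esub>"

definition has_presentation ::
  "('g, 'm) monoid_scheme \<Rightarrow> ('s \<Rightarrow> 'g) \<Rightarrow> 's set \<Rightarrow> 's word set \<Rightarrow> bool" where
  "has_presentation G f S R \<longleftrightarrow>
     f ` S \<subseteq> carrier G \<and>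
     word_value G f ` lists (S \<times> UNIV) = carrier G \<and>
     (\<forall>w \<in> lists (S \<times> UNIV). word_value G f w = \<one>\<^bsub>G\<^esub> \<longleftrightarrow> word_equiv S R w [])"

datatype goeritz_gen = Gen\<alpha> | Gen\<beta> | Gen\<gamma> | Gen\<delta> | Gen\<rho> | Gen\<sigma>

definition goeritz_gens :: "nat \<Rightarrow> goeritz_gen set" where
  "goeritz_gens p =
     (if p = 2 then {Gen\<beta>, Gen\<rho>, Gen\<gamma>}
      else if p = 3 then {Gen\<alpha>, Gen\<beta>, Gen\<delta>, Gen\<gamma>}
      else {Gen\<alpha>, Gen\<beta>, Gen\<gamma>, Gen\<sigma>})"

abbreviation positive_word :: "'s list \<Rightarrow> 's word" where
  "positive_word ss \<equiv> map (\<lambda>s. (s, True)) ss"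

definition commutator_word :: "'s \<Rightarrow> 's \<Rightarrow> 's word" where
  "commutator_word s t = [(s, True), (t, True), (s, False), (t, False)]"

text \<open>The direct factor generated by \<open>\<alpha>\<close> is expressed by commutator relators.\<close>

definition goeritz_relators :: "nat \<Rightarrow> goeritz_gen word set" where
  "goeritz_relators p =
     (if p = 2 then
        {positive_word [Gen\<rho>, Gen\<rho>, Gen\<rho>, Gen\<rho>], positive_word [Gen\<gamma>, Gen\<gamma>],
         positive_word [Gen\<gamma>, Gen\<rho>, Gen\<gamma>, Gen\<rho>],
         positive_word [Gen\<rho>, Gen\<rho>, Gen\<beta>, Gen\<rho>, Gen\<rho>] @ [(Gen\<beta>, False)]}
      else if p = 3 then
        {positive_word [Gen\<alpha>, Gen\<alpha>], positive_word [Gen\<delta>, Gen\<delta>, Gen\<delta>],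
         positive_word [Gen\<gamma>, Gen\<gamma>], positive_word [Gen\<gamma>, Gen\<delta>, Gen\<gamma>, Gen\<delta>]} \<union>
        commutator_word Gen\<alpha> ` {Gen\<beta>, Gen\<delta>, Gen\<gamma>}
      else
        {positive_word [Gen\<alpha>, Gen\<alpha>], positive_word [Gen\<gamma>, Gen\<gamma>], positive_word [Gen\<sigma>, Gen\<sigma>]} \<union>
        commutator_word Gen\<alpha> ` {Gen\<beta>, Gen\<gamma>, Gen\<sigma>})"

fun gen_matrix :: "nat \<Rightarrow> goeritz_gen \<Rightarrow> int^4^4" where
  "gen_matrix p Gen\<alpha> = - mat 1"
| "gen_matrix p Gen\<beta> = vector
     [vector [1, 0, 0, 0], vector [0, -1, 0, 0], vector [0, 0, 1, 0], vector [0, 0, 0, -1]]"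
| "gen_matrix p Gen\<gamma> = vector
     [vector [1, 1, 0, 0], vector [0, -1, 0, 0], vector [0, 0, 1, 0], vector [0, 0, 1, -1]]"
| "gen_matrix p Gen\<delta> = vector
     [vector [-2, -1, 1, -1], vector [3, 1, -1, 0], vector [0, 0, 1, -3], vector [0, 0, 1, -2]]"
| "gen_matrix p Gen\<rho> = vector
     [vector [1, 1, 1, -1], vector [-2, -1, -1, 0], vector [0, 0, -1, 2], vector [0, 0, -1, 1]]"
| "gen_matrix p Gen\<sigma> = vector
     [vector [1, 0, 0, 1], vector [- int p, -1, -1, 0], vector [0, 0, 1, - int p],
      vector [0, 0, 0, -1]]"

text \<open>The data supplied by Cho's theorem: \<open>f\<close> assigns to the symbols isotopy classes that present
  the Goeritz group and act on homology by the listed matrices.  With a fixed orientation convention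
  for \<open>M\<close>, the matrices for \<open>p = 3\<close> and \<open>p \<noteq> 3\<close> belong to opposite orientations: they preserve
  the kernel of \<open>H\<^sub>1(F) \<rightarrow> H\<^sub>1(V)\<close> only if it contains \<open>3b + a\<close>, respectively \<open>pb - a\<close>.  Hence the
  orientations \<open>\<mu>\<close> and \<open>\<nu>\<close> must be left arbitrary.\<close>

definition cho_generators ::
  "nat \<Rightarrow> 'a topology \<Rightarrow> 'a chain set \<Rightarrow> 'a set \<Rightarrow> 'a set \<Rightarrow> 'a set \<Rightarrow>
   (4 \<Rightarrow> complex \<Rightarrow> 'a) \<Rightarrow> (goeritz_gen \<Rightarrow> ('a \<Rightarrow> 'a) set) \<Rightarrow> bool" where
  "cho_generators p M \<mu> F V W c f \<longleftrightarrow>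
     has_presentation (goeritz_group M \<mu> V W) f (goeritz_gens p) (goeritz_relators p) \<and>
     (\<forall>s \<in> goeritz_gens p. star (subtopology M F) c (f s) = gen_matrix p s)"

text \<open>The matrix form defining \<open>\<S>\<^sub>p\<close>, with sign \<open>\<epsilon>\<close>.\<close>

definition star_form :: "int \<Rightarrow> int \<Rightarrow> int \<Rightarrow> int \<Rightarrow> int \<Rightarrow> int \<Rightarrow> int \<Rightarrow> int \<Rightarrow> int^4^4" where
  "star_form p \<epsilon> \<omega> \<Delta> k l m n = map_matrix ((*) \<omega>) (vector
     [vector [k * p + 1, l, \<epsilon> * (k - \<Delta> * n), \<epsilon> * \<Delta> * m],
      vector [m * p, n * p + \<Delta>, \<epsilon> * m, 0],
      vector [0, 0, \<Delta> * n * p + 1, - \<Delta> * m * p],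
      vector [0, 0, - \<Delta> * l, \<Delta> * (k * p + 1)]])"

end

(*
A homeomorphism of a coset acts on H_1(F) by g_*, independently of the representative, so that
v' = g_* v.  Substituting the entries of g_* shows delta' = delta and that the four quantities in
claims 3 and 4 are, up to sign, m, kp+1, np+Delta and l times delta; the gcd is preserved because the
lower right block is invertible over the integers.  Claim 4 is thereby reduced to the inequality
|mp| <= 2|kp+1| or p|l| <= 2|np+Delta| for the upper left block of g_*.  For small p it follows
from the determinant.  In general the determinant does not suffice (p = 8, k = -1, l = -4, m = 2,
n = 1, Delta = 1 violates it): one needs Cho's generators, whose blocks generate, up to signs, the
group of (1 1; 0 1) and (1 0; p 1), and a ping-pong argument on the first letter of a reduced word.
*)
theory Submission
  imports Defs
begin

section \<open>Ping-pong for upper and lower shears\<close>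

text \<open>Reduced words for matrices \<open>(A B; C D)\<close>, typed by their leftmost letter:
  left multiplication by \<open>(1 t; 0 1)\<close> or by \<open>(1 0; t*p 1)\<close>. Diagonal sign
  matrices have both types, so that a letter of either kind may follow; they also account for
  determinant -1.\<close>

inductive upper_word lower_word :: "int \<Rightarrow> int \<Rightarrow> int \<Rightarrow> int \<Rightarrow> int \<Rightarrow> bool" for p where
  upper_base: "\<bar>A\<bar> = 1 \<Longrightarrow> \<bar>D\<bar> = 1 \<Longrightarrow> upper_word p A 0 0 D"
| upper_step: "lower_word p A B C D \<Longrightarrow> t \<noteq> 0 \<Longrightarrow> upper_word p (A + t * C) (B + t * D) C D"
| lower_base: "\<bar>A\<bar> = 1 \<Longrightarrow> \<bar>D\<bar> = 1 \<Longrightarrow> lower_word p A 0 0 D"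
| lower_step: "upper_word p A B C D \<Longrightarrow> t \<noteq> 0 \<Longrightarrow> lower_word p A B (C + t * p * A) (D + t * p * B)"

text \<open>Conjugation by \<open>diag(1, -1)\<close> inverts every shear: the sign passes through
  the word, negating each \<open>t\<close>, and is absorbed by the diagonal base.\<close>

lemma upper_lower_word_reflect:
  shows "upper_word p A B C D \<Longrightarrow> upper_word p A B (- C) (- D)"
    and "lower_word p A B C D \<Longrightarrow> lower_word p A B (- C) (- D)"
proof (induction rule: upper_word_lower_word.inducts)
  case (upper_base A D)
  then show ?case using upper_word_lower_word.upper_base[of A "- D" p] by simp
next
  case (upper_step A B C D t)
  then show ?case using upper_word_lower_word.upper_step[of p A B "- C" "- D" "- t"] by simp
next
  case (lower_base A D)
  then show ?case using upper_word_lower_word.lower_base[of A "- D" p] by simp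
next
  case (lower_step A B C D t)
  then show ?case
    using upper_word_lower_word.lower_step[of p A B "- C" "- D" "- t"] by (simp add: algebra_simps)
qed

text \<open>The scalar -1 commutes with every shear, so only the base changes sign.\<close>

lemma upper_lower_word_uminus:
  shows "upper_word p A B C D \<Longrightarrow> upper_word p (- A) (- B) (- C) (- D)"
    and "lower_word p A B C D \<Longrightarrow> lower_word p (- A) (- B) (- C) (- D)"
proof (induction rule: upper_word_lower_word.inducts)
  case (upper_base A D)
  then show ?case using upper_word_lower_word.upper_base[of "- A" "- D" p] by simp
next
  case (upper_step A B C D t)
  then show ?case
    using upper_word_lower_word.upper_step[of p "- A" "- B" "- C" "- D" t]
    by (simp add: algebra_simps)
next
  case (lower_base A D)
  then show ?case using upper_word_lower_word.lower_base[of "- A" "- D" p] by simp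
next
  case (lower_step A B C D t)
  then show ?case
    using upper_word_lower_word.lower_step[of p "- A" "- B" "- C" "- D" t]
    by (simp add: algebra_simps)
qed

text \<open>Ping-pong for the linear action on the columns \<open>(A, C)\<close> and \<open>(B, D)\<close>, with a different
  pair of regions for each column.\<close>

lemma upper_lower_word_bounds:
  assumes "p \<ge> 4"
  shows "upper_word p A B C D \<Longrightarrow> \<bar>C\<bar> \<le> 2 * \<bar>A\<bar> \<and> (2 * \<bar>D\<bar> \<le> p * \<bar>B\<bar> \<or> B = 0)"
    and "lower_word p A B C D \<Longrightarrow> (2 * \<bar>A\<bar> \<le> \<bar>C\<bar> \<or> C = 0) \<and> p * \<bar>B\<bar> \<le> 2 * \<bar>D\<bar>"
proof (induction rule: upper_word_lower_word.inducts)
  \<comment> \<open>The alternatives \<open>B = 0\<close> and \<open>C = 0\<close> serve the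
    diagonal base words; once a letter has been added, the inequality itself holds.\<close>
  case (upper_step A B C D t)
  have t: "\<bar>x\<bar> \<le> \<bar>t * x\<bar>" for x
    using upper_step.hyps mult_right_mono[of 1 "\<bar>t\<bar>" "\<bar>x\<bar>"] by (simp add: abs_mult)
  \<comment> \<open>Since |t| >= 1, \<open>p |B + t D| >= p |D| - p |B| >= 4 |D| - 2 |D|\<close>;
    the last bound uses \<open>p \<ge> 4\<close> and the region of lower words.\<close>
  have "p * \<bar>D\<bar> \<le> p * (\<bar>B + t * D\<bar> + \<bar>B\<bar>)"
    using t[of D] assms by (intro mult_left_mono) auto
  moreover have "4 * \<bar>D\<bar> \<le> p * \<bar>D\<bar>"
    using assms by (intro mult_right_mono) auto
  ultimately have "2 * \<bar>D\<bar> \<le> p * \<bar>B + t * D\<bar>"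
    using upper_step.IH by (simp add: algebra_simps)
  \<comment> \<open>In the first column either \<open>C = 0\<close> or |A| is at most half of |C|,
    so adding \<open>t * C\<close> leaves at least half of |C|.\<close>
  moreover have "\<bar>t * C\<bar> \<le> \<bar>A + t * C\<bar> + \<bar>A\<bar>" by linarith
  then have "\<bar>C\<bar> \<le> 2 * \<bar>A + t * C\<bar>"
    using t[of C] upper_step.IH by auto
  ultimately show ?case by blast
next
  case (lower_step A B C D t)
  have t: "p * \<bar>x\<bar> \<le> \<bar>t * p * x\<bar>" for x
    using lower_step.hyps assms mult_right_mono[of 1 "\<bar>t\<bar>" "p * \<bar>x\<bar>"]
    by (simp add: abs_mult mult.assoc)
  \<comment> \<open>Here the letter itself carries the factor \<open>p\<close>: a shift by at least
    4 |A| outweighs |C| <= 2 |A|.\<close>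
  have "4 * \<bar>A\<bar> \<le> p * \<bar>A\<bar>"
    using assms by (intro mult_right_mono) auto
  then have "2 * \<bar>A\<bar> \<le> \<bar>C + t * p * A\<bar>"
    using t[of A] lower_step.IH by linarith
  moreover have "\<bar>t * p * B\<bar> \<le> \<bar>D + t * p * B\<bar> + \<bar>D\<bar>" by linarith
  then have "p * \<bar>B\<bar> \<le> 2 * \<bar>D + t * p * B\<bar>"
    using t[of B] lower_step.IH by auto
  ultimately show ?case by blast
qed (use assms in auto)

section \<open>Closure of the words under signs and shears\<close>

definition pingpong_word :: "int \<Rightarrow> int \<Rightarrow> int \<Rightarrow> int \<Rightarrow> int \<Rightarrow> bool" where
  "pingpong_word p A B C D \<longleftrightarrow> upper_word p A B C D \<or> lower_word p A B C D"

lemma pingpong_word_one: "pingpong_word p 1 0 0 1"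
  by (simp add: pingpong_word_def upper_base)

lemma pingpong_word_reflect: "pingpong_word p A B C D \<Longrightarrow> pingpong_word p A B (- C) (- D)"
  unfolding pingpong_word_def using upper_lower_word_reflect by blast

lemma pingpong_word_uminus: "pingpong_word p A B C D \<Longrightarrow> pingpong_word p (- A) (- B) (- C) (- D)"
  unfolding pingpong_word_def using upper_lower_word_uminus by blast

text \<open>In front of a word of the other type the shear is a new letter; in front of its own type
  it merges with the first letter, the parameters adding up.\<close>

lemma pingpong_word_shear_upper:
  assumes "pingpong_word p A B C D"
  shows "pingpong_word p (A + t * C) (B + t * D) C D"
proof (cases "t = 0")
  case False
  from assms consider "lower_word p A B C D" | "upper_word p A B C D"
    unfolding pingpong_word_def by blast
  then show ?thesis
  proof cases
    case 1
    then show ?thesis using False upper_step pingpong_word_def by blast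
  next
    case 2
    then show ?thesis
    proof cases
      case upper_base
      \<comment> \<open>A diagonal word is reread as the other type, so that the letter may be put
        in front of it.\<close>
      then have "lower_word p A B C D" by (simp add: lower_base)
      then show ?thesis using False upper_step pingpong_word_def by blast
    next
      case (upper_step A' B' r)
      then have eq: "A + t * C = A' + (r + t) * C" "B + t * D = B' + (r + t) * D"
        by (simp_all add: algebra_simps)
      show ?thesis
        unfolding eq pingpong_word_def
        using upper_step(3) upper_word_lower_word.upper_step[of p A' B' C D "r + t"]
        \<comment> \<open>For \<open>r + t = 0\<close> the two letters cancel and the remaining
          lower word is left.\<close>
        by (cases "r + t = 0") auto
    qed
  qed
qed (use assms in simp)

lemma pingpong_word_shear_lower:
  assumes "pingpong_word p A B C D"
  shows "pingpong_word p A B (C + t * p * A) (D + t * p * B)"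
proof (cases "t = 0")
  case False
  from assms consider "upper_word p A B C D" | "lower_word p A B C D"
    unfolding pingpong_word_def by blast
  then show ?thesis
  proof cases
    case 1
    then show ?thesis using False lower_step pingpong_word_def by blast
  next
    case 2
    then show ?thesis
    proof cases
      case lower_base
      then have "upper_word p A B C D" by (simp add: upper_base)
      then show ?thesis using False lower_step pingpong_word_def by blast
    next
      case (lower_step C' D' r)
      then have eq: "C + t * p * A = C' + (r + t) * p * A" "D + t * p * B = D' + (r + t) * p * B"
        by (simp_all add: algebra_simps)
      show ?thesis
        unfolding eq pingpong_word_def
        using lower_step(3) upper_word_lower_word.lower_step[of p A B C' D' "r + t"]
        by (cases "r + t = 0") auto
    qed
  qed
qed (use assms in simp)

text \<open>The type of the leftmost letter decides: upper gives the first alternative, lower the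
  second.\<close>

lemma pingpong_word_bounds:
  assumes "pingpong_word p A B C D" "p \<ge> 4"
  shows "\<bar>C\<bar> \<le> 2 * \<bar>A\<bar> \<or> p * \<bar>B\<bar> \<le> 2 * \<bar>D\<bar>"
  using assms upper_lower_word_bounds unfolding pingpong_word_def by blast

section \<open>The generators for \<open>p \<ge> 4\<close> on the upper left block\<close>

text \<open>The vanishing lower left block is carried along because it makes the upper left block
  multiplicative.\<close>

definition top_left_pingpong :: "int \<Rightarrow> int^4^4 \<Rightarrow> bool" where
  "top_left_pingpong p Q \<longleftrightarrow> (\<forall>i \<in> {3, 4}. \<forall>j \<in> {1, 2}. Q $ i $ j = 0) \<and>
     pingpong_word p (Q $ 1 $ 1) (Q $ 1 $ 2) (Q $ 2 $ 1) (Q $ 2 $ 2)"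

lemma vector_4 [simp]:
  "(vector [x, y, z, w] :: 'b::zero^4) $ 1 = x"
  "(vector [x, y, z, w] :: 'b::zero^4) $ 2 = y"
  "(vector [x, y, z, w] :: 'b::zero^4) $ 3 = z"
  "(vector [x, y, z, w] :: 'b::zero^4) $ 4 = w"
  unfolding vector_def by simp_all

lemma top_left_pingpong_one: "top_left_pingpong p (mat 1)"
  by (simp add: top_left_pingpong_def mat_def pingpong_word_one)

text \<open>On the upper left block \<open>Gen\<alpha>\<close> is -1, \<open>Gen\<beta>\<close> is
  \<open>diag(1, -1)\<close>, and \<open>Gen\<gamma>\<close>, \<open>Gen\<sigma>\<close> are
  \<open>diag(1, -1)\<close> times the upper, respectively lower, shear with
  \<open>t = 1\<close>.\<close>

lemma top_left_pingpong_gen_matrix_mult: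
  assumes Q: "top_left_pingpong (int p) Q" and s: "s \<in> {Gen\<alpha>, Gen\<beta>, Gen\<gamma>, Gen\<sigma>}"
  shows "top_left_pingpong (int p) (gen_matrix p s ** Q)"
proof -
  note word = Q[unfolded top_left_pingpong_def, THEN conjunct2]
  have "top_left_pingpong (int p) (gen_matrix p Gen\<alpha> ** Q)"
    using Q pingpong_word_uminus[OF word]
    by (simp add: top_left_pingpong_def matrix_matrix_mult_def sum_4 mat_def)
  moreover have "top_left_pingpong (int p) (gen_matrix p Gen\<beta> ** Q)"
    using Q pingpong_word_reflect[OF word]
    by (simp add: top_left_pingpong_def matrix_matrix_mult_def sum_4)
  moreover have "top_left_pingpong (int p) (gen_matrix p Gen\<gamma> ** Q)"
    using Q pingpong_word_reflect[OF pingpong_word_shear_upper[OF word, of 1]]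
    by (simp add: top_left_pingpong_def matrix_matrix_mult_def sum_4)
  moreover have "top_left_pingpong (int p) (gen_matrix p Gen\<sigma> ** Q)"
    using Q pingpong_word_reflect[OF pingpong_word_shear_lower[OF word, of 1]]
    by (simp add: top_left_pingpong_def matrix_matrix_mult_def sum_4 add.commute)
  ultimately show ?thesis using s by auto
qed

text \<open>No relator makes \<open>Gen\<beta>\<close> an involution, but its matrix is one. Hence
  inverse letters act by the same matrices as the letters.\<close>

lemma gen_matrix_involutive:
  assumes s: "s \<in> {Gen\<alpha>, Gen\<beta>, Gen\<gamma>, Gen\<sigma>}"
  shows "gen_matrix p s ** gen_matrix p s = mat 1"
  using s by (auto simp: vec_eq_iff forall_4 matrix_matrix_mult_def sum_4 mat_def)

section \<open>Determinant estimate and arithmetic of the matrix form\<close>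

text \<open>If both alternatives fail, multiplying the failures gives
  \<open>(2|A| + 1)(2|D| + 1) <= p |BC| <= 4 (|AD| + 1)\<close>, whereas the left side is at least
  \<open>4|AD| + 5\<close> for nonzero \<open>A\<close> and \<open>D\<close>.\<close>

lemma dominated_entry_small_p:
  fixes p A B C D \<Delta> :: int
  assumes p: "0 \<le> p" "p \<le> 4" and "A \<noteq> 0" "D \<noteq> 0" "\<bar>\<Delta>\<bar> = 1" and det: "A * D - B * C = \<Delta>"
  shows "\<bar>C\<bar> \<le> 2 * \<bar>A\<bar> \<or> p * \<bar>B\<bar> \<le> 2 * \<bar>D\<bar>"
proof (rule ccontr)
  assume "\<not> ?thesis"
  then have "2 * \<bar>A\<bar> + 1 \<le> \<bar>C\<bar>" "2 * \<bar>D\<bar> + 1 \<le> p * \<bar>B\<bar>" by auto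
  then have "(2 * \<bar>A\<bar> + 1) * (2 * \<bar>D\<bar> + 1) \<le> \<bar>C\<bar> * (p * \<bar>B\<bar>)"
    by (intro mult_mono) auto
  also have "\<dots> = p * \<bar>B * C\<bar>"
    by (simp add: abs_mult algebra_simps)
  also have "\<dots> \<le> p * (\<bar>A * D\<bar> + 1)"
    using assms by (intro mult_left_mono) auto
  also have "\<dots> \<le> 4 * (\<bar>A * D\<bar> + 1)"
    using p by (intro mult_right_mono) auto
  finally show False
    using assms by (simp add: abs_mult algebra_simps)
qed

text \<open>Put \<open>A = k*p + 1\<close>, \<open>D = n*p + \<Delta>\<close> and
  \<open>T = (A l*p; m D)\<close>, of determinant \<Delta>. Then \<open>(s, x)\<close> transforms by
  \<omega> times \<open>T\<close>, and \<open>(b, p*y)\<close> by \<omega> times the inverse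
  transpose of \<open>T\<close>. So \<delta>, the pairing of these two vectors, is invariant, and
  each of the four combinations isolates one of \<open>m\<close>, \<open>A\<close>,
  \<open>D\<close>, \<open>l\<close> times \<delta>, up to sign.\<close>

lemma star_form_arithmetic:
  fixes p a x b y a' x' b' y' k l m n \<omega> \<Delta> \<epsilon> s s' \<delta> \<delta>' :: int
  assumes v': "vector [a', x', b', y'] = star_form p \<epsilon> \<omega> \<Delta> k l m n *v vector [a, x, b, y]"
    and \<omega>: "\<omega> \<in> {1, -1}" and \<Delta>: "\<Delta> \<in> {1, -1}"
    and det: "\<Delta> = (k * p + 1) * (n * p + \<Delta>) - l * (m * p)"
    and s: "s = a * p + \<epsilon> * b" "s' = a' * p + \<epsilon> * b'"
    and \<delta>: "\<delta> = b * s + x * y * p" "\<delta>' = b' * s' + x' * y' * p"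
  shows "[b' = \<omega> * b] (mod p)" and "gcd b y = gcd b' y'" and "\<delta>' = \<delta>"
    and "\<Delta> * b * x' - b' * x = \<omega> * \<Delta> * m * \<delta>"
    and "b * s' + \<Delta> * x * y' * p = \<omega> * (k * p + 1) * \<delta>"
    and "b' * s + \<Delta> * x' * y * p = \<omega> * \<Delta> * (n * p + \<Delta>) * \<delta>"
    and "y * s' - \<Delta> * y' * s = \<omega> * l * \<delta>"
proof -
  define A D where "A = k * p + 1" and "D = n * p + \<Delta>"
  have \<Delta>2: "\<Delta> * \<Delta> = 1" and \<omega>2: "\<omega> * \<omega> = 1" using \<Delta> \<omega> by auto
  have det': "A * D = l * m * p + \<Delta>" using det by (simp add: A_def D_def algebra_simps)
  have "vector [a', x', b', y'] $ i = (star_form p \<epsilon> \<omega> \<Delta> k l m n *v vector [a, x, b, y]) $ i" for i :: 4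
    using v' by simp
  from this[of 1] this[of 2] this[of 3] this[of 4]
  have a': "a' = \<omega> * (A * a + l * x + \<epsilon> * (k - \<Delta> * n) * b + \<epsilon> * \<Delta> * m * y)"
    and x0: "x' = \<omega> * (m * p * a + D * x + \<epsilon> * m * b)"
    and b0: "b' = \<omega> * ((\<Delta> * n * p + 1) * b - \<Delta> * m * p * y)"
    and y0: "y' = \<omega> * (\<Delta> * A * y - \<Delta> * l * b)"
    by (simp_all add: star_form_def map_matrix_def matrix_vector_mult_def sum_4 A_def D_def algebra_simps)
  \<comment> \<open>Replacing \<open>a\<close> by \<open>s\<close> hides \<epsilon> and leaves two
    separate 2 by 2 actions, on \<open>(s, x)\<close> and on \<open>(b, y)\<close>.\<close>
  have x': "x' = \<omega> * (m * s + D * x)" unfolding x0 s by (simp add: algebra_simps)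
  have b': "b' = \<omega> * \<Delta> * (D * b - m * p * y)"
    unfolding b0 D_def using \<Delta> by (auto simp: algebra_simps)
  have y': "y' = \<omega> * \<Delta> * (A * y - l * b)" unfolding y0 by (simp add: algebra_simps)
  have s': "s' = \<omega> * (A * s + l * p * x)"
    unfolding s(2) a' b0 s(1) A_def by (simp add: algebra_simps)
  show "[b' = \<omega> * b] (mod p)"
    unfolding b0 cong_iff_dvd_diff by (rule dvdI[of _ _ "\<omega> * \<Delta> * (n * b - m * y)"]) (simp add: algebra_simps)
  have det2: "\<Delta> * (A * D - l * m * p) = 1" unfolding det' using \<Delta>2 by (simp add: algebra_simps)
  \<comment> \<open>The adjugate of the action on \<open>(b, y)\<close> recovers the old pair from
    the new one, so that the two gcds divide each other.\<close>
  have "\<omega> * (A * b' + m * p * y') = (\<omega> * \<omega>) * (\<Delta> * (A * D - l * m * p)) * b"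
    unfolding b' y' by (simp add: algebra_simps)
  then have b: "b = \<omega> * (A * b' + m * p * y')" unfolding det2 \<omega>2 by simp
  have "\<omega> * (l * b' + D * y') = (\<omega> * \<omega>) * (\<Delta> * (A * D - l * m * p)) * y"
    unfolding b' y' by (simp add: algebra_simps)
  then have y: "y = \<omega> * (l * b' + D * y')" unfolding det2 \<omega>2 by simp
  show "gcd b y = gcd b' y'"
  proof (rule zdvd_antisym_nonneg)
    show "gcd b y dvd gcd b' y'"
      unfolding b' y' by (intro gcd_greatest dvd_mult dvd_diff) (auto intro: dvd_mult)
    have "gcd b' y' dvd b" "gcd b' y' dvd y"
      by (subst b, intro dvd_mult dvd_add; simp) (subst y, intro dvd_mult dvd_add; simp)
    then show "gcd b' y' dvd gcd b y" by (rule gcd_greatest)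
  qed auto
  have "b' * s' + x' * y' * p = (\<omega> * \<omega>) * (\<Delta> * (A * D - l * m * p)) * (b * s + x * y * p)"
    unfolding x' b' y' s' by (simp add: algebra_simps)
  then show "\<delta>' = \<delta>" unfolding \<delta> det2 \<omega>2 by simp
  show "\<Delta> * b * x' - b' * x = \<omega> * \<Delta> * m * \<delta>"
    unfolding \<delta> x' b' by (simp add: algebra_simps)
  show "b * s' + \<Delta> * x * y' * p = \<omega> * (k * p + 1) * \<delta>"
    unfolding \<delta> s' y' A_def[symmetric] using \<Delta> by (auto simp: algebra_simps)
  show "b' * s + \<Delta> * x' * y * p = \<omega> * \<Delta> * (n * p + \<Delta>) * \<delta>"
    unfolding \<delta> x' b' D_def[symmetric] by (simp add: algebra_simps)
  show "y * s' - \<Delta> * y' * s = \<omega> * l * \<delta>"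
    unfolding \<delta> s' y' using \<Delta> by (auto simp: algebra_simps)
qed

section \<open>Homology classes of curves\<close>

abbreviation circle :: "complex topology" where
  "circle \<equiv> top_of_set (sphere 0 1)"

lemma simple_closed_curve_continuous: "simple_closed_curve X k \<Longrightarrow> continuous_map circle X k"
  unfolding simple_closed_curve_def
  by (meson continuous_map_into_fulltopology embedding_map_def homeomorphic_imp_continuous_map)

text \<open>The two faces of the simplex are the values at the parameters 1 and 0, where
  \<open>cis\<close> agrees, so the boundary vanishes.\<close>

lemma loop_relcycle:
  assumes "continuous_map circle X k"
  shows "singular_relcycle 1 X {}
           (frag_of (\<lambda>t \<in> standard_simplex 1. k (cis (2 * pi * t 1))))"
proof -
  let ?\<sigma> = "\<lambda>t \<in> standard_simplex 1. k (cis (2 * pi * t 1))"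
  have "continuous_map (subtopology (powertop_real UNIV) (standard_simplex 1)) euclideanreal (\<lambda>t. t 1)"
    by (intro continuous_map_from_subtopology continuous_map_product_projection) simp
  moreover have "continuous_map euclideanreal circle (\<lambda>r. cis (2 * pi * r))"
    by (auto simp: continuous_map_in_subtopology intro!: continuous_intros)
  ultimately have "continuous_map (subtopology (powertop_real UNIV) (standard_simplex 1)) X
      (k \<circ> ((\<lambda>r. cis (2 * pi * r)) \<circ> (\<lambda>t. t 1)))"
    by (intro continuous_map_compose[OF _ assms] continuous_map_compose)
  then have "continuous_map (subtopology (powertop_real UNIV) (standard_simplex 1)) X ?\<sigma>"
    by (rule continuous_map_eq) simp
  then have "singular_simplex 1 X ?\<sigma>"
    by (simp add: singular_simplex_def)
  moreover have "singular_face 1 0 ?\<sigma> = singular_face 1 1 ?\<sigma>"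
    by (rule ext) (auto simp: singular_face_def standard_simplex_0 standard_simplex_def
        simplical_face_def)
  then have "chain_boundary 1 (frag_of ?\<sigma>) = 0"
    by (simp add: chain_boundary_of)
  ultimately show ?thesis
    by (simp add: singular_cycle singular_chain_of)
qed

lemma curve_class_in_carrier:
  assumes "continuous_map circle X k"
  shows "curve_class X k \<in> carrier (homology_group 1 X)"
  using carrier_relative_homology_group[of 1 X "{}"] loop_relcycle[OF assms]
  by (auto simp: curve_class_def)

lemma hom_induced_curve_class:
  assumes k: "continuous_map circle X k" and h: "continuous_map X Y h"
  shows "hom_induced 1 X {} Y {} h (curve_class X k) = curve_class Y (h \<circ> k)"
proof -
  have "simplex_map 1 h (\<lambda>t \<in> standard_simplex 1. k (cis (2 * pi * t 1)))
      = (\<lambda>t \<in> standard_simplex 1. (h \<circ> k) (cis (2 * pi * t 1)))"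
    by (auto simp: simplex_map_def)
  then show ?thesis
    using hom_induced_chain_map[OF h _ loop_relcycle[OF k], of "{}"]
    by (simp add: curve_class_def)
qed

text \<open>By naturality both sides are images of the class of the identity loop of the circle,
  under the homotopic maps \<open>k \<circ> r\<close> and \<open>k\<close>.\<close>

lemma curve_class_reparametrize:
  assumes k: "continuous_map circle X k" and r: "homotopic_with (\<lambda>_. True) circle circle r id"
  shows "curve_class X (k \<circ> r) = curve_class X k"
proof -
  have cr: "continuous_map circle circle r"
    using homotopic_with_imp_continuous_maps[OF r] by blast
  have "curve_class X (k \<circ> r) = hom_induced 1 circle {} X {} (k \<circ> r) (curve_class circle id)"
    using hom_induced_curve_class[of circle id X "k \<circ> r"] continuous_map_compose[OF cr k] by simp
  also have "hom_induced 1 circle {} X {} (k \<circ> r) = hom_induced 1 circle {} X {} (k \<circ> id)"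
    using homotopic_with_compose_continuous_map_left[OF r k, of "\<lambda>_. True"]
    by (intro homology_homotopy_empty) simp
  also have "hom_induced 1 circle {} X {} (k \<circ> id) (curve_class circle id) = curve_class X k"
    using hom_induced_curve_class[of circle id X k] k by simp
  finally show ?thesis .
qed

lemma curve_class_cong:
  assumes "\<And>z. z \<in> sphere 0 1 \<Longrightarrow> k z = l z"
  shows "curve_class X k = curve_class X l"
proof -
  have "(\<lambda>t \<in> standard_simplex 1. k (cis (2 * pi * t 1))) = (\<lambda>t \<in> standard_simplex 1. l (cis (2 * pi * t 1)))"
    using assms by (auto simp: restrict_def)
  then show ?thesis by (simp add: curve_class_def)
qed

lemma hom_induced_carried_curve_class:
  assumes h: "continuous_map X X h" "carries_curve h k k'"
    and k: "continuous_map circle X k" and k': "continuous_map circle X k'"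
  shows "hom_induced 1 X {} X {} h (curve_class X k) = curve_class X k'"
proof -
  obtain r where r: "homotopic_with (\<lambda>_. True) circle circle r id"
    "\<And>z. z \<in> sphere 0 1 \<Longrightarrow> h (k z) = k' (r z)"
    using h(2) unfolding carries_curve_def by blast
  have "curve_class X (h \<circ> k) = curve_class X (k' \<circ> r)"
    using r(2) by (intro curve_class_cong) auto
  then show ?thesis
    using hom_induced_curve_class[OF k h(1)] curve_class_reparametrize[OF k' r(1)] by simp
qed

lemma hom_finprod:
  assumes G: "comm_group G" and H: "comm_group H" and \<phi>: "\<phi> \<in> hom G H"
    and f: "f \<in> A \<rightarrow> carrier G"
  shows "\<phi> (finprod G f A) = finprod H (\<phi> \<circ> f) A"
proof -
  interpret G: comm_group G by (rule G)
  interpret H: comm_group H by (rule H)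
  interpret group_hom G H \<phi>
    by (rule group_hom.intro) (auto simp: group_hom_axioms_def \<phi> G.is_group H.is_group)
  show ?thesis using f
  \<comment> \<open>Over an infinite index set both products are the unit by convention;
    \<open>auto\<close> closes that case at the end.\<close>
  proof (induction A rule: infinite_finite_induct)
    case (insert a A)
    then have "\<phi> \<circ> f \<in> insert a A \<rightarrow> carrier H" by (auto intro!: hom_closed)
    with insert show ?case by (simp add: Pi_iff)
  qed auto
qed

section \<open>Integer coordinates on first homology and matrices of endomorphisms\<close>

locale homology_frame =
  fixes X :: "'a topology" and c :: "4 \<Rightarrow> complex \<Rightarrow> 'a"
  assumes curves: "\<And>i. simple_closed_curve X (c i)"
    and basis: "homology_basis X c"
begin

abbreviation "H \<equiv> homology_group 1 X"
abbreviation "comb \<equiv> class_comb X c"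
abbreviation "coords \<equiv> homology_coords X c"

sublocale H: comm_group H
  by simp

lemma basis_in_carrier: "curve_class X (c i) \<in> carrier H"
  by (intro curve_class_in_carrier simple_closed_curve_continuous curves)

lemma comb_in_carrier: "comb v \<in> carrier H"
  using basis by (auto simp: homology_basis_def bij_betw_def)

lemma comb_coords: "\<xi> \<in> carrier H \<Longrightarrow> comb (coords \<xi>) = \<xi>"
  using basis unfolding homology_basis_def homology_coords_def bij_betw_def
  by (simp add: f_inv_into_f)

lemma coords_comb: "coords (comb v) = v"
  using basis unfolding homology_basis_def homology_coords_def bij_betw_def by simp

lemma comb_zero: "comb 0 = \<one>\<^bsub>H\<^esub>"
  by (simp add: class_comb_def H.finprod_one_eqI)

text \<open>The frame is given merely as a bijection; this makes it an isomorphism, by commutativity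
  of \<open>H\<close>.\<close>

lemma comb_add: "comb (v + w) = comb v \<otimes>\<^bsub>H\<^esub> comb w"
proof -
  have "comb (v + w) = finprod H (\<lambda>i. curve_class X (c i) [^]\<^bsub>H\<^esub> (v $ i) \<otimes>\<^bsub>H\<^esub>
      curve_class X (c i) [^]\<^bsub>H\<^esub> (w $ i)) UNIV"
    by (simp add: class_comb_def H.int_pow_mult basis_in_carrier)
  also have "\<dots> = comb v \<otimes>\<^bsub>H\<^esub> comb w"
    unfolding class_comb_def by (intro H.finprod_multf) (auto simp: basis_in_carrier)
  finally show ?thesis .
qed

lemma comb_smult: "comb (z *s v) = comb v [^]\<^bsub>H\<^esub> z"
proof -
  \<comment> \<open>Taking powers is an endomorphism of a commutative group, hence passes through
    the product.\<close>
  have "(\<lambda>\<xi>. \<xi> [^]\<^bsub>H\<^esub> z) \<in> hom H H"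
    by (intro homI) (auto simp: H.int_pow_distrib)
  from hom_finprod[OF H.comm_group_axioms H.comm_group_axioms this,
      of "\<lambda>i. curve_class X (c i) [^]\<^bsub>H\<^esub> (v $ i)" UNIV]
  have "comb v [^]\<^bsub>H\<^esub> z
      = finprod H ((\<lambda>\<xi>. \<xi> [^]\<^bsub>H\<^esub> z) \<circ> (\<lambda>i. curve_class X (c i) [^]\<^bsub>H\<^esub> (v $ i))) UNIV"
    unfolding class_comb_def by (simp add: basis_in_carrier)
  then show ?thesis
    by (simp add: class_comb_def o_def H.int_pow_pow basis_in_carrier mult.commute)
qed

lemma comb_sum: "finite S \<Longrightarrow> comb (sum u S) = finprod H (\<lambda>i. comb (u i)) S"
  by (induction S rule: finite_induct) (auto simp: comb_zero comb_add comb_in_carrier)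

lemma comb_axis: "comb (axis j 1) = curve_class X (c j)"
proof -
  have "comb (axis j 1) = finprod H (\<lambda>i. if j = i then curve_class X (c i) else \<one>\<^bsub>H\<^esub>) UNIV"
    unfolding class_comb_def by (intro H.finprod_cong') (auto simp: axis_def basis_in_carrier)
  then show ?thesis
    using H.finprod_singleton[of j UNIV "\<lambda>i. curve_class X (c i)"] by (simp add: basis_in_carrier)
qed

text \<open>The column convention is that of \<open>star\<close>, which is this matrix for the map
  induced by a representative.\<close>

definition hom_matrix :: "('a chain set \<Rightarrow> 'a chain set) \<Rightarrow> int^4^4" where
  "hom_matrix \<phi> = (\<chi> i j. coords (\<phi> (curve_class X (c j))) $ i)"

text \<open>Expand \<open>comb v\<close> into powers of the basis classes, apply \<phi> to each
  factor, and collect the columns.\<close>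

lemma hom_comb:
  assumes "\<phi> \<in> hom H H"
  shows "\<phi> (comb v) = comb (hom_matrix \<phi> *v v)"
proof -
  have \<phi>: "\<phi> \<xi> \<in> carrier H" if "\<xi> \<in> carrier H" for \<xi>
    using assms that by (auto simp: hom_def)
  have col: "comb (column j (hom_matrix \<phi>)) = \<phi> (curve_class X (c j))" for j
  proof -
    have "column j (hom_matrix \<phi>) = coords (\<phi> (curve_class X (c j)))"
      by (simp add: column_def hom_matrix_def vec_eq_iff)
    then show ?thesis by (simp add: comb_coords \<phi> basis_in_carrier)
  qed
  have "\<phi> (comb v) = finprod H (\<lambda>j. \<phi> (curve_class X (c j) [^]\<^bsub>H\<^esub> (v $ j))) UNIV"
    unfolding class_comb_def
    using hom_finprod[OF H.comm_group_axioms H.comm_group_axioms assms,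
        of "\<lambda>j. curve_class X (c j) [^]\<^bsub>H\<^esub> (v $ j)" UNIV]
    by (simp add: basis_in_carrier o_def)
  also have "\<dots> = finprod H (\<lambda>j. comb (v $ j *s column j (hom_matrix \<phi>))) UNIV"
    by (simp add: hom_int_pow[OF assms] basis_in_carrier H.is_group comb_smult col)
  also have "\<dots> = comb (hom_matrix \<phi> *v v)"
    by (simp add: comb_sum matrix_mult_sum)
  finally show ?thesis .
qed

lemma hom_matrix_mult_coords:
  assumes "\<phi> \<in> hom H H" "\<xi> \<in> carrier H"
  shows "coords (\<phi> \<xi>) = hom_matrix \<phi> *v coords \<xi>"
  using hom_comb[OF assms(1), of "coords \<xi>"] by (simp add: comb_coords coords_comb assms(2))

lemma hom_matrix_compose:
  assumes "\<phi> \<in> hom H H" "\<psi> \<in> hom H H"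
  shows "hom_matrix (\<phi> \<circ> \<psi>) = hom_matrix \<phi> ** hom_matrix \<psi>"
proof -
  have \<psi>: "\<psi> (curve_class X (c j)) \<in> carrier H" for j
    using assms(2) basis_in_carrier by (auto simp: hom_def)
  show ?thesis
    using hom_matrix_mult_coords[OF assms(1) \<psi>]
    by (simp add: hom_matrix_def[of "\<phi> \<circ> \<psi>"] vec_eq_iff matrix_matrix_mult_def
        matrix_vector_mult_def hom_matrix_def[of \<psi>])
qed

lemma hom_matrix_one:
  assumes "\<And>\<xi>. \<xi> \<in> carrier H \<Longrightarrow> \<phi> \<xi> = \<xi>"
  shows "hom_matrix \<phi> = mat 1"
proof -
  have "coords (\<phi> (curve_class X (c j))) = axis j 1" for j
    using coords_comb[of "axis j 1"] by (simp add: assms basis_in_carrier comb_axis)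
  then show ?thesis
    by (simp add: hom_matrix_def vec_eq_iff mat_def axis_def)
qed

end

section \<open>The Goeritz group and its action on homology\<close>

text \<open>Elements of \<open>BijGroup\<close> are extensional, so unit, products and inverses
  agree with the ordinary functions only on \<open>topspace M\<close>; this transfers the property
  between them.\<close>

lemma preserves_splitting_cong:
  assumes "V \<subseteq> topspace M" "W \<subseteq> topspace M" "\<And>x. x \<in> topspace M \<Longrightarrow> h x = k x"
  shows "preserves_splitting M V W h \<longleftrightarrow> preserves_splitting M V W k"
proof -
  have "h ` V = k ` V" "h ` W = k ` W"
    using assms by (auto intro!: image_cong)
  moreover have "homeomorphic_map M M h \<longleftrightarrow> homeomorphic_map M M k"
    using homeomorphic_map_eq[of M M h k] homeomorphic_map_eq[of M M k h] assms(3) by auto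
  ultimately show ?thesis by (simp add: preserves_splitting_def)
qed

lemma preserves_splitting_comp:
  "preserves_splitting M V W h \<Longrightarrow> preserves_splitting M V W k \<Longrightarrow> preserves_splitting M V W (h \<circ> k)"
  unfolding preserves_splitting_def by (metis homeomorphic_map_compose image_comp)

text \<open>Since \<open>h\<close> is onto, any left inverse coincides on the space with the
  continuous inverse. This applies to the restricted \<open>inv_into\<close> of the bijection
  group.\<close>

lemma preserves_splitting_left_inverse:
  assumes h: "preserves_splitting M V W h" and VW: "V \<subseteq> topspace M" "W \<subseteq> topspace M"
    and i: "\<And>x. x \<in> topspace M \<Longrightarrow> i (h x) = x"
  shows "preserves_splitting M V W i"
proof -
  obtain g where g: "homeomorphic_maps M M h g"
    using h homeomorphic_map_maps[of M M h] by (auto simp: preserves_splitting_def)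
  then have g': "homeomorphic_map M M g" "h ` topspace M = topspace M"
    "\<And>x. x \<in> topspace M \<Longrightarrow> g (h x) = x"
    using homeomorphic_imp_surjective_map[of M M h] by (auto simp: homeomorphic_maps_map)
  have "g y = i y" if "y \<in> topspace M" for y
  proof -
    have "y \<in> h ` topspace M" using that g'(2) by simp
    then obtain x where "x \<in> topspace M" "y = h x" by (rule imageE)
    then show ?thesis using g'(3) i by simp
  qed
  then have "homeomorphic_map M M i"
    by (rule homeomorphic_map_eq[OF g'(1)])
  moreover have "i ` A = A" if "h ` A = A" "A \<subseteq> topspace M" for A
  proof -
    have "i ` h ` A = (\<lambda>x. x) ` A"
      unfolding image_image using i that(2) by (intro image_cong) auto
    then show ?thesis using that(1) by simp
  qed
  ultimately show ?thesis using h VW unfolding preserves_splitting_def by blast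
qed

section \<open>The homeomorphism group and its quotient by isotopy\<close>

locale splitting =
  fixes M :: "'a topology" and \<mu> :: "'a chain set" and V W :: "'a set"
  assumes V_sub: "V \<subseteq> topspace M" and W_sub: "W \<subseteq> topspace M"
    and \<mu>_carrier: "\<mu> \<in> carrier (homology_group 3 M)"
begin

abbreviation "G \<equiv> splitting_homeo_group M \<mu> V W"
abbreviation "N \<equiv> isotopic_to_id M \<mu> V W"
abbreviation "P \<equiv> preserves_splitting M V W"

lemmas P_cong = preserves_splitting_cong[OF V_sub W_sub]

lemma carrier_G:
  "h \<in> carrier G \<longleftrightarrow> h \<in> Bij (topspace M) \<and> P h \<and> hom_induced 3 M {} M {} h \<mu> = \<mu>"
  by (simp add: splitting_homeo_group_def)

lemma P_continuous: "P h \<Longrightarrow> continuous_map M M h"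
  by (simp add: preserves_splitting_def homeomorphic_imp_continuous_map)

lemma subgroup_BijGroup:
  "subgroup (carrier G) (BijGroup (topspace M))"
proof (rule group.subgroupI[OF group_BijGroup])
  show "carrier G \<subseteq> carrier (BijGroup (topspace M))"
    by (auto simp: carrier_G BijGroup_def)
  have "(\<lambda>x \<in> topspace M. x) \<in> carrier G"
  proof -
    have "P id" by (simp add: preserves_splitting_def)
    then have "P (\<lambda>x \<in> topspace M. x)" using P_cong[of "\<lambda>x \<in> topspace M. x" id] by simp
    moreover from this have "hom_induced 3 M {} M {} (\<lambda>x \<in> topspace M. x) \<mu> = \<mu>"
      using \<mu>_carrier by (intro hom_induced_id_gen P_continuous) auto
    ultimately show ?thesis by (simp add: carrier_G id_Bij)
  qed
  then show "carrier G \<noteq> {}" by blast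
next
  fix h assume h: "h \<in> carrier G"
  let ?i = "\<lambda>x \<in> topspace M. inv_into (topspace M) h x"
  have i: "?i (h x) = x" if "x \<in> topspace M" for x
    using h that by (auto simp: carrier_G Bij_def bij_betw_def)
  have P: "P ?i"
  proof (rule preserves_splitting_left_inverse[OF _ V_sub W_sub])
    show "P h" using h by (simp add: carrier_G)
  qed (rule i)
  \<comment> \<open>As \<open>h\<close> fixes \<mu>, functoriality turns the action of the inverse
    on \<mu> into that of \<open>?i \<circ> h\<close>, which is the identity on the space.\<close>
  have "hom_induced 3 M {} M {} ?i \<mu> = hom_induced 3 M {} M {} ?i (hom_induced 3 M {} M {} h \<mu>)"
    using h by (simp add: carrier_G)
  also have "\<dots> = hom_induced 3 M {} M {} (?i \<circ> h) \<mu>"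
    using hom_induced_compose_empty[OF P_continuous[of h] P_continuous[OF P], of 3] h
    by (simp add: carrier_G)
  also have "\<dots> = \<mu>"
  proof (rule hom_induced_id_gen)
    show "continuous_map M M (?i \<circ> h)"
      using h by (intro continuous_map_compose[OF P_continuous P_continuous[OF P]])
        (simp add: carrier_G)
    show "(?i \<circ> h) x = x" if "x \<in> topspace M" for x
      using i[OF that] by simp
  qed (rule \<mu>_carrier)
  finally show "inv\<^bsub>BijGroup (topspace M)\<^esub> h \<in> carrier G"
    using h P by (simp add: carrier_G inv_BijGroup restrict_inv_into_Bij)
next
  fix h k assume hk: "h \<in> carrier G" "k \<in> carrier G"
  have eq: "h \<otimes>\<^bsub>BijGroup (topspace M)\<^esub> k = compose (topspace M) h k"
    using hk by (simp add: carrier_G BijGroup_def)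
  have "hom_induced 3 M {} M {} (compose (topspace M) h k) = hom_induced 3 M {} M {} (h \<circ> k)"
    by (rule hom_induced_eq) (simp add: compose_def)
  moreover have "P (compose (topspace M) h k)"
    using hk P_cong[of "compose (topspace M) h k" "h \<circ> k"] preserves_splitting_comp[of M V W h k]
    by (auto simp: compose_def carrier_G)
  ultimately show "h \<otimes>\<^bsub>BijGroup (topspace M)\<^esub> k \<in> carrier G"
    using hk hom_induced_compose_empty[of M M k M h 3] P_continuous
    by (auto simp: eq carrier_G compose_Bij)
qed

lemma G_eq: "G = BijGroup (topspace M) \<lparr>carrier := carrier G\<rparr>"
  by (simp add: splitting_homeo_group_def)

sublocale G: group G
  using subgroup.subgroup_is_group[OF subgroup_BijGroup group_BijGroup] G_eq by simp

lemma mult_G: "h \<in> carrier G \<Longrightarrow> k \<in> carrier G \<Longrightarrow> h \<otimes>\<^bsub>G\<^esub> k = compose (topspace M) h k"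
  by (simp add: splitting_homeo_group_def BijGroup_def)

lemma one_G: "\<one>\<^bsub>G\<^esub> = (\<lambda>x \<in> topspace M. x)"
  by (simp add: splitting_homeo_group_def BijGroup_def)

lemma inv_G_apply:
  assumes "h \<in> carrier G" "x \<in> topspace M"
  shows "h ((inv\<^bsub>G\<^esub> h) x) = x" "(inv\<^bsub>G\<^esub> h) (h x) = x"
  using G.r_inv[OF assms(1)] G.l_inv[OF assms(1)] assms
  by (auto simp: mult_G one_G compose_def fun_eq_iff restrict_def split: if_splits)

lemma isotopy_eq:
  assumes "homotopic_with P M M h k"
    "\<And>x. x \<in> topspace M \<Longrightarrow> h' x = h x" "\<And>x. x \<in> topspace M \<Longrightarrow> k' x = k x"
  shows "homotopic_with P M M h' k'"
  using assms P_cong by (rule homotopic_with_eq)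

lemma isotopy_comp_right:
  "homotopic_with P M M h k \<Longrightarrow> P j \<Longrightarrow> homotopic_with P M M (h \<circ> j) (k \<circ> j)"
  by (rule homotopic_with_compose_continuous_map_right[of P])
    (auto intro: preserves_splitting_comp P_continuous)

lemma isotopy_comp_left:
  "homotopic_with P M M h k \<Longrightarrow> P j \<Longrightarrow> homotopic_with P M M (j \<circ> h) (j \<circ> k)"
  by (rule homotopic_with_compose_continuous_map_left[of P])
    (auto intro: preserves_splitting_comp P_continuous)

lemma N_iff: "h \<in> N \<longleftrightarrow> h \<in> carrier G \<and> homotopic_with P M M id h"
  by (simp add: isotopic_to_id_def)

lemma G_P: "h \<in> carrier G \<Longrightarrow> P h"
  by (simp add: carrier_G)

text \<open>Inverses, products and conjugates come from composing an isotopy, on either side, with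
  fixed maps preserving the splitting, and from reversing and concatenating isotopies.\<close>

lemma N_normal: "N \<lhd> G"
proof -
  have "subgroup N G"
  proof (rule G.subgroupI)
    show "N \<subseteq> carrier G" by (auto simp: N_iff)
    have "P id" by (simp add: preserves_splitting_def)
    then have "homotopic_with P M M id id" by simp
    then have "homotopic_with P M M id \<one>\<^bsub>G\<^esub>" by (rule isotopy_eq) (auto simp: one_G)
    then show "N \<noteq> {}" using N_iff by blast
  next
    fix h assume h: "h \<in> N"
    then have hG: "h \<in> carrier G" and hom: "homotopic_with P M M id h" by (auto simp: N_iff)
    have "homotopic_with P M M (h \<circ> inv\<^bsub>G\<^esub> h) (id \<circ> inv\<^bsub>G\<^esub> h)"
      using hG by (intro isotopy_comp_right homotopic_with_symD[OF hom] G_P) simp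
    then have "homotopic_with P M M id (inv\<^bsub>G\<^esub> h)"
      by (rule isotopy_eq) (auto simp: inv_G_apply hG)
    then show "inv\<^bsub>G\<^esub> h \<in> N" using hG by (simp add: N_iff)
  next
    fix h k assume "h \<in> N" "k \<in> N"
    then have hk: "h \<in> carrier G" "k \<in> carrier G"
      and hom: "homotopic_with P M M id h" "homotopic_with P M M id k" by (auto simp: N_iff)
    have "homotopic_with P M M (id \<circ> k) (h \<circ> k)"
      using hk by (intro isotopy_comp_right hom G_P)
    then have "homotopic_with P M M id (h \<circ> k)"
      using homotopic_with_trans[OF hom(2)] by simp
    then have "homotopic_with P M M id (h \<otimes>\<^bsub>G\<^esub> k)"
      by (rule isotopy_eq) (auto simp: mult_G hk compose_def)
    then show "h \<otimes>\<^bsub>G\<^esub> k \<in> N" using hk by (simp add: N_iff)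
  qed
  moreover have "x \<otimes>\<^bsub>G\<^esub> h \<otimes>\<^bsub>G\<^esub> inv\<^bsub>G\<^esub> x \<in> N" if x: "x \<in> carrier G" and h: "h \<in> N" for x h
  proof -
    have hG: "h \<in> carrier G" and hom: "homotopic_with P M M id h" using h by (auto simp: N_iff)
    have i: "(inv\<^bsub>G\<^esub> x) y \<in> topspace M" if "y \<in> topspace M" for y
      using Bij_imp_funcset[of "inv\<^bsub>G\<^esub> x"] G.inv_closed[OF x] that by (auto simp: carrier_G)
    have "homotopic_with P M M (x \<circ> id \<circ> inv\<^bsub>G\<^esub> x) (x \<circ> h \<circ> inv\<^bsub>G\<^esub> x)"
      using x by (intro isotopy_comp_right isotopy_comp_left hom G_P) auto
    then have "homotopic_with P M M id (x \<otimes>\<^bsub>G\<^esub> h \<otimes>\<^bsub>G\<^esub> inv\<^bsub>G\<^esub> x)"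
    proof (rule isotopy_eq)
      fix y assume "y \<in> topspace M"
      then show "(x \<otimes>\<^bsub>G\<^esub> h \<otimes>\<^bsub>G\<^esub> inv\<^bsub>G\<^esub> x) y = (x \<circ> h \<circ> inv\<^bsub>G\<^esub> x) y"
        using mult_G[OF G.m_closed[OF x hG] G.inv_closed[OF x]] mult_G[OF x hG] i
        by (simp add: compose_def)
    qed (simp add: inv_G_apply x)
    then show ?thesis using x hG by (simp add: N_iff)
  qed
  ultimately show ?thesis by (simp add: G.normal_inv_iff)
qed

abbreviation "\<G> \<equiv> goeritz_group M \<mu> V W"

sublocale \<G>: group \<G>
  unfolding goeritz_group_def by (rule normal.factorgroup_is_group[OF N_normal])

section \<open>Action of isotopy classes on the homology of the surface\<close>

abbreviation "X \<equiv> subtopology M (V \<inter> W)"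
abbreviation act :: "('a \<Rightarrow> 'a) \<Rightarrow> 'a chain set \<Rightarrow> 'a chain set" where
  "act h \<equiv> hom_induced 1 X {} X {} h"

lemma P_maps_surface:
  assumes "P h" shows "h ` (V \<inter> W) \<subseteq> V \<inter> W"
  using assms by (auto simp: preserves_splitting_def)

lemma P_continuous_surface:
  assumes "P h" shows "continuous_map X X h"
  using P_maps_surface[OF assms] P_continuous[OF assms]
  by (auto simp: continuous_map_in_subtopology intro: continuous_map_from_subtopology)

text \<open>Every stage of the isotopy preserves \<open>V\<close> and \<open>W\<close>, hence
  \<open>V \<inter> W\<close>; the isotopy therefore restricts to a homotopy of the surface.\<close>

lemma act_isotopic:
  assumes "homotopic_with P M M h k"
  shows "act h = act k"
proof (rule homology_homotopy_empty)
  obtain f where f: "continuous_map (prod_topology (top_of_set {0..1::real}) M) M f"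
    "\<And>x. f (0, x) = h x" "\<And>x. f (1, x) = k x" "\<And>t. t \<in> {0..1} \<Longrightarrow> P (\<lambda>x. f (t, x))"
    using assms unfolding homotopic_with_def by blast
  have "f (t, x) \<in> V \<inter> W" if "t \<in> {0..1}" "x \<in> V \<inter> W" for t x
    using P_maps_surface[OF f(4)[OF that(1)]] that(2) by blast
  moreover have "continuous_map (prod_topology (top_of_set {0..1::real}) X) M f"
    unfolding prod_topology_subtopology(2) by (rule continuous_map_from_subtopology[OF f(1)])
  ultimately have "continuous_map (prod_topology (top_of_set {0..1::real}) X) X f"
    by (intro continuous_map_into_subtopology) auto
  then show "homotopic_with (\<lambda>_. True) X X h k"
    unfolding homotopic_with_def using f by blast
qed

lemma act_mult:
  assumes "h \<in> carrier G" "k \<in> carrier G"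
  shows "act (h \<otimes>\<^bsub>G\<^esub> k) = act h \<circ> act k"
proof -
  have "act (h \<otimes>\<^bsub>G\<^esub> k) = act (h \<circ> k)"
    by (rule hom_induced_eq) (auto simp: mult_G assms compose_def)
  then show ?thesis
    using hom_induced_compose_empty[of X X k X h 1] assms P_continuous_surface G_P by auto
qed

lemma carrier_\<G>_cases:
  assumes "g \<in> carrier \<G>"
  obtains h where "h \<in> carrier G" "g = N #>\<^bsub>G\<^esub> h"
  using assms by (auto simp: goeritz_group_def carrier_FactGroup)

lemma coset_mem_carrier: "g \<in> carrier \<G> \<Longrightarrow> h \<in> g \<Longrightarrow> h \<in> carrier G"
  by (elim carrier_\<G>_cases) (auto simp: r_coset_def N_iff)

text \<open>Members of a coset differ by left factors isotopic to the identity. This frees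
  \<open>star\<close> from the representative picked by \<open>SOME\<close>.\<close>

lemma act_coset_eq:
  assumes g: "g \<in> carrier \<G>" and h: "h \<in> g" "k \<in> g"
  shows "act h = act k"
proof -
  obtain h0 where h0: "h0 \<in> carrier G" "g = N #>\<^bsub>G\<^esub> h0" using g by (rule carrier_\<G>_cases)
  have "act h = act h0" if h: "h \<in> g" for h
  proof -
    obtain n where n: "n \<in> N" "h = n \<otimes>\<^bsub>G\<^esub> h0"
      using h h0(2) by (auto simp: r_coset_def)
    then have nG: "n \<in> carrier G" and hom: "homotopic_with P M M id n" by (auto simp: N_iff)
    have "homotopic_with P M M (id \<circ> h0) (n \<circ> h0)"
      using h0 by (intro isotopy_comp_right hom G_P)
    then have "homotopic_with P M M h0 h"
      by (rule isotopy_eq) (auto simp: n nG h0 mult_G compose_def)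
    then show ?thesis using act_isotopic by metis
  qed
  then show ?thesis using h by metis
qed

lemma coset_nonempty: "g \<in> carrier \<G> \<Longrightarrow> \<exists>h. h \<in> g"
  using G.rcos_self[OF _ normal_imp_subgroup[OF N_normal]] by (metis carrier_\<G>_cases)

end

section \<open>The star map as a homomorphism, and induction over words\<close>

locale framed_splitting = splitting + homology_frame "subtopology M (V \<inter> W)" c for c
begin

lemma star_eq: "g \<in> carrier \<G> \<Longrightarrow> h \<in> g \<Longrightarrow> star X c g = hom_matrix (act h)"
  unfolding star_def hom_matrix_def using act_coset_eq[of g "SOME h. h \<in> g" h] someI[of "\<lambda>h. h \<in> g" h]
  by simp

lemma star_mult:
  assumes g: "g \<in> carrier \<G>" "g' \<in> carrier \<G>"
  shows "star X c (g \<otimes>\<^bsub>\<G>\<^esub> g') = star X c g ** star X c g'"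
proof -
  obtain h h' where h: "h \<in> g" "h' \<in> g'" using g coset_nonempty by blast
  then have hG: "h \<in> carrier G" "h' \<in> carrier G" using g coset_mem_carrier by blast+
  \<comment> \<open>Multiplication in the quotient is the setwise product of cosets.\<close>
  have "h \<otimes>\<^bsub>G\<^esub> h' \<in> g \<otimes>\<^bsub>\<G>\<^esub> g'"
    using h by (auto simp: goeritz_group_def set_mult_def)
  then have "star X c (g \<otimes>\<^bsub>\<G>\<^esub> g') = hom_matrix (act (h \<otimes>\<^bsub>G\<^esub> h'))"
    using g by (intro star_eq) auto
  then show ?thesis
    using hG by (simp add: act_mult hom_matrix_compose hom_induced_hom star_eq[OF g(1) h(1)] star_eq[OF g(2) h(2)])
qed

lemma star_one: "star X c \<one>\<^bsub>\<G>\<^esub> = mat 1"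
proof -
  have "\<one>\<^bsub>G\<^esub> \<in> \<one>\<^bsub>\<G>\<^esub>"
    using normal_imp_subgroup[OF N_normal] by (simp add: goeritz_group_def subgroup.one_closed)
  moreover have "act \<one>\<^bsub>G\<^esub> \<xi> = \<xi>" if "\<xi> \<in> carrier H" for \<xi>
    using that V_sub by (intro hom_induced_id_gen P_continuous_surface G_P) (auto simp: one_G intro: G.one_closed[unfolded one_G])
  ultimately show ?thesis
    using star_eq[OF \<G>.one_closed] hom_matrix_one by simp
qed

lemma star_inv_involutive:
  assumes g: "g \<in> carrier \<G>" and inv: "star X c g ** star X c g = mat 1"
  shows "star X c (inv\<^bsub>\<G>\<^esub> g) = star X c g"
proof -
  have "star X c (inv\<^bsub>\<G>\<^esub> g) = star X c (inv\<^bsub>\<G>\<^esub> g) ** (star X c g ** star X c g)"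
    by (simp only: inv matrix_mul_rid)
  also have "\<dots> = star X c (inv\<^bsub>\<G>\<^esub> g \<otimes>\<^bsub>\<G>\<^esub> g) ** star X c g"
    using star_mult[of "inv\<^bsub>\<G>\<^esub> g" g] g by (simp only: \<G>.inv_closed matrix_mul_assoc)
  finally show ?thesis using g by (simp add: star_one)
qed

text \<open>Every class is the value of a word, and a letter put in front multiplies the matrix on
  the left. By \<open>inv\<close>, a letter and its inverse have the same matrix, so one
  \<open>step\<close> covers both.\<close>

lemma star_word_induct:
  assumes cho: "has_presentation \<G> f S R"
    and inv: "\<And>s. s \<in> S \<Longrightarrow> star X c (f s) ** star X c (f s) = mat 1"
    and one: "Q (mat 1)" and step: "\<And>s B. s \<in> S \<Longrightarrow> Q B \<Longrightarrow> Q (star X c (f s) ** B)"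
    and g: "g \<in> carrier \<G>"
  shows "Q (star X c g)"
proof -
  have fS: "f s \<in> carrier \<G>" if "s \<in> S" for s
    using cho[unfolded has_presentation_def, THEN conjunct1] that by blast
  have "word_value \<G> f w \<in> carrier \<G> \<and> Q (star X c (word_value \<G> f w))"
    if "w \<in> lists (S \<times> UNIV)" for w
    using that
  proof (induction w)
    case Nil
    then show ?case by (simp add: word_value_def star_one one)
  next
    case (Cons l w)
    obtain s e where l: "l = (s, e)" by fastforce
    let ?u = "if e then f s else inv\<^bsub>\<G>\<^esub> (f s)"
    have s: "s \<in> S" using Cons.hyps l by simp
    have u: "?u \<in> carrier \<G>" "star X c ?u = star X c (f s)"
      using fS[OF s] star_inv_involutive inv[OF s] by auto
    have "word_value \<G> f (l # w) = ?u \<otimes>\<^bsub>\<G>\<^esub> word_value \<G> f w"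
      by (simp add: word_value_def l)
    then show ?case using Cons.IH u step[OF s] by (simp add: star_mult)
  qed
  moreover obtain w where "w \<in> lists (S \<times> UNIV)" "g = word_value \<G> f w"
    using cho[unfolded has_presentation_def, THEN conjunct2, THEN conjunct1] g by (metis imageE)
  ultimately show ?thesis by blast
qed

lemma coords_carried_curve:
  assumes g: "g \<in> carrier \<G>" "h \<in> g" "carries_curve h K K'"
    and K: "simple_closed_curve X K" "simple_closed_curve X K'"
  shows "coords (curve_class X K') = star X c g *v coords (curve_class X K)"
proof -
  note K = K[THEN simple_closed_curve_continuous]
  have "act h (curve_class X K) = curve_class X K'"
    by (rule hom_induced_carried_curve_class[OF P_continuous_surface g(3) K])
      (intro G_P coset_mem_carrier[OF g(1,2)])
  then show ?thesis
    using hom_matrix_mult_coords[OF hom_induced_hom curve_class_in_carrier[OF K(1)], of h]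
      star_eq[OF g(1,2)]
    by metis
qed

end

section \<open>From the matrix of \<open>g\<close> to the four claims\<close>

theorem theorem4p3:
  fixes p :: nat and M :: "'a topology"
    and F' V' W' F V W :: "'a set"
    and \<mu> :: "'a chain set" and \<nu> :: "(real^3) chain set"
    and c :: "4 \<Rightarrow> complex \<Rightarrow> 'a"
    and f :: "goeritz_gen \<Rightarrow> ('a \<Rightarrow> 'a) set"
    and g :: "('a \<Rightarrow> 'a) set"
    and K K' :: "complex \<Rightarrow> 'a"
    and a x b y a' x' b' y' :: int
    and k l m n \<omega> \<Delta> \<epsilon> s s' \<delta> \<delta>' :: int
  assumes p: "p \<ge> 2"
    and lens: "lens_space p 1 M"
    and genus1: "heegaard_splitting 1 M F' V' W'" "torus_knot_bounds p M F' V' W'"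
    and genus2: "heegaard_splitting 2 M F V W" "stabilization M F' V' W' F V W"
    and orientation: "orientation_class M \<mu>" "space_orientation \<nu>"
    and basis: "standard_curves M \<mu> \<nu> F V W c"
    and cho: "cho_generators p M \<mu> F V W c f"
    and K: "simple_closed_curve (subtopology M F) K"
      "homology_coords (subtopology M F) c (curve_class (subtopology M F) K) = vector [a, x, b, y]"
    and K': "simple_closed_curve (subtopology M F) K'"
      "homology_coords (subtopology M F) c (curve_class (subtopology M F) K') = vector [a', x', b', y']"
    and g: "g \<in> carrier (goeritz_group M \<mu> V W)" "\<exists>h \<in> g. carries_curve h K K'"
    and \<epsilon>: "\<epsilon> = (if p = 3 then -1 else 1)"
    and star_g: "star (subtopology M F) c g = star_form (int p) \<epsilon> \<omega> \<Delta> k l m n"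
    and \<omega>: "\<omega> \<in> {1, -1}"
    and \<Delta>: "\<Delta> \<in> {1, -1}"
      "\<Delta> = det (vector [vector [k * int p + 1, l], vector [m * int p, n * int p + \<Delta>]] :: int^2^2)"
    and s: "s = a * int p + \<epsilon> * b" "s' = a' * int p + \<epsilon> * b'"
    and \<delta>: "\<delta> = b * s + x * y * int p" "\<delta>' = b' * s' + x' * y' * int p"
  shows "[b' = \<omega> * b] (mod int p) \<and>
    gcd b y = gcd b' y' \<and>
    (\<forall>d \<in> {\<delta>, \<delta>'}.
       d dvd \<Delta> * b * x' - b' * x \<and>
       d dvd b * s' + \<Delta> * x * y' * int p \<and>
       d dvd b' * s + \<Delta> * x' * y * int p \<and>
       d dvd y * s' - \<Delta> * y' * s) \<and>
    (\<bar>(\<Delta> * b * x' - b' * x) * int p\<bar> \<le> 2 * \<bar>b * s' + \<Delta> * x * y' * int p\<bar> \<or>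
     int p * \<bar>y * s' - \<Delta> * y' * s\<bar> \<le> 2 * \<bar>b' * s + \<Delta> * x' * y * int p\<bar>)"
proof -
  let ?X = "subtopology M (V \<inter> W)"
  have F: "F = V \<inter> W" and VW: "V \<subseteq> topspace M" "W \<subseteq> topspace M"
    using genus2(1) closedin_subset unfolding heegaard_splitting_def by auto
  interpret framed_splitting M \<mu> V W c
  proof
    show "V \<subseteq> topspace M" "W \<subseteq> topspace M" by (rule VW)+
    show "\<mu> \<in> carrier (homology_group 3 M)"
      using orientation(1) by (simp add: orientation_class_def is_generator_def)
    show "simple_closed_curve ?X (c i)" for i
      using basis by (simp add: standard_curves_def F)
    show "homology_basis ?X c"
      using basis by (simp add: standard_curves_def F)
  qed
  obtain h where h: "h \<in> g" "carries_curve h K K'" using g(2) by blast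
  have v': "vector [a', x', b', y'] = star_form (int p) \<epsilon> \<omega> \<Delta> k l m n *v vector [a, x, b, y]"
    using coords_carried_curve[OF g(1) h] K K' star_g by (simp add: F)
  have det: "\<Delta> = (k * int p + 1) * (n * int p + \<Delta>) - l * (m * int p)"
    using \<Delta>(2) by (simp add: det_2)
  note arith = star_form_arithmetic[OF v' \<omega> \<Delta>(1) det s \<delta>]
  \<comment> \<open>This is claim 4 with the common factor |\<delta>| removed.\<close>
  have dominated: "\<bar>m * int p\<bar> \<le> 2 * \<bar>k * int p + 1\<bar> \<or> int p * \<bar>l\<bar> \<le> 2 * \<bar>n * int p + \<Delta>\<bar>"
  proof (cases "p \<ge> 4")
    case True
    have gens: "goeritz_gens p = {Gen\<alpha>, Gen\<beta>, Gen\<gamma>, Gen\<sigma>}"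
      using True by (simp add: goeritz_gens_def)
    have pres: "has_presentation \<G> f (goeritz_gens p) (goeritz_relators p)"
      and star_f: "\<And>t. t \<in> goeritz_gens p \<Longrightarrow> star ?X c (f t) = gen_matrix p t"
      using cho by (simp_all add: cho_generators_def F)
    have "top_left_pingpong (int p) (star ?X c g)"
    proof (rule star_word_induct[OF pres])
      fix t assume t: "t \<in> goeritz_gens p"
      show "star ?X c (f t) ** star ?X c (f t) = mat 1"
        unfolding star_f[OF t] using t by (intro gen_matrix_involutive) (simp add: gens)
      fix B assume "top_left_pingpong (int p) B"
      then show "top_left_pingpong (int p) (star ?X c (f t) ** B)"
        unfolding star_f[OF t] using t
        by (intro top_left_pingpong_gen_matrix_mult) (simp_all add: gens)
    qed (rule top_left_pingpong_one, rule g(1))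
    then have "pingpong_word (int p) (\<omega> * (k * int p + 1)) (\<omega> * l) (\<omega> * (m * int p))
        (\<omega> * (n * int p + \<Delta>))"
      using star_g by (simp add: F top_left_pingpong_def star_form_def map_matrix_def)
    \<comment> \<open>Absolute values discard the common sign \<omega>.\<close>
    from pingpong_word_bounds[OF this] True \<omega> show ?thesis
      by (auto simp: abs_mult)
  next
    case False
    \<comment> \<open>Now \<open>p\<close> is 2 or 3. The diagonal entries are units modulo
      \<open>p\<close>, hence nonzero, as the determinant estimate requires.\<close>
    have "q * int p + u \<noteq> 0" if "\<bar>u\<bar> = 1" for q u
    proof
      assume "q * int p + u = 0"
      then have "u = int p * (- q)" by (simp add: algebra_simps)
      then have "int p dvd \<bar>u\<bar>" by simp
      then show False using that p by simp
    qed
    from this[of 1 k] this[of \<Delta> n] \<Delta>(1)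
    have nonzero: "k * int p + 1 \<noteq> 0" "n * int p + \<Delta> \<noteq> 0" by auto
    show ?thesis
      by (rule dominated_entry_small_p[OF _ _ nonzero _ det[symmetric]]) (use False \<Delta>(1) in auto)
  qed
  have "\<bar>\<omega>\<bar> = 1" "\<bar>\<Delta>\<bar> = 1" using \<omega> \<Delta>(1) by auto
  \<comment> \<open>Multiplying by |\<delta>| restores the four quantities, also when \<delta> is
    zero.\<close>
  moreover from dominated have "\<bar>m * int p\<bar> * \<bar>\<delta>\<bar> \<le> 2 * \<bar>k * int p + 1\<bar> * \<bar>\<delta>\<bar> \<or>
      int p * \<bar>l\<bar> * \<bar>\<delta>\<bar> \<le> 2 * \<bar>n * int p + \<Delta>\<bar> * \<bar>\<delta>\<bar>"
    by (auto intro: mult_right_mono)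
  ultimately show ?thesis
    using arith(1,2) unfolding arith(3-7) by (auto simp: abs_mult mult_ac)
qed

end
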